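(* Let $R$ be a commutative ring with identity, let $S$ be a multiplicative subset of $R$, let $I$ be an ideal of $R$ and let $M$ be an $R/I$-module. Assume that $I\cap S=\emptyset$, so that $T:=\{s+I\in R/I : s\in S\}$ is a multiplicative subset of $R/I$. Then: 1. $M$ is an $S$-finite $R$-module if and only if $M$ is a $T$-finite $R/I$-module. 2. If $M$ is an $S$-finitely presented $R$-module, then $M$ is a $T$-finitely presented $R/I$-module. The converse holds when $I$ is an $S$-finite ideal of $R$.
   Context: All rings are commutative with identity and all modules are unitary. A multiplicative subset of a ring is a subset containing $1$ and closed under multiplication. An $R/I$-module is regarded as an $R$-module via the canonical surjection $R\to R/I$. For a ring $R$ and a multiplicative subset $S$ of $R$: an $R$-module $M$ is $S$-finite if there exist a finitely generated submodule $N$ of $M$ and $s\in S$ such that $sM\subseteq N$ (an ideal is $S$-finite if it is so as an $R$-module); an $R$-module $M$ is $S$-finitely presented if there exists an exact sequence of $R$-modules $0\to K\to F\to M\to 0$ with $K$ an $S$-finite module and $F$ a finitely generated free module. The notions of $T$-finite and $T$-finitely presented $R/I$-modules are these notions for the ring $R/I$ and its multiplicative subset $T$. *)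

theory Defs
  imports "Jordan_Normal_Form.Missing_VectorSpace" "HOL-Algebra.QuotRing"
begin

text \<open>
  Modules, submodules, spans, linear independence and module homomorphisms are those of the
  locale \<open>module\<close> and its extension in the theory \<open>LinearCombinations\<close>.  The name \<open>submodule\<close>
  denotes the locale of the latter theory (argument order: ring, subset, module).  A
  multiplicative subset of a ring \<open>R\<close> is a \<open>submonoid\<close> of \<open>R\<close>, which always refers to the
  multiplication of \<open>R\<close>.
\<close>

definition fg_module :: "('a, 'r) ring_scheme \<Rightarrow> ('a, 'm, 'e) module_scheme \<Rightarrow> bool" where
  "fg_module R M \<longleftrightarrow>
     module R M \<and> (\<exists>A. finite A \<and> A \<subseteq> carrier M \<and> module.span R M A = carrier M)"

definition free_module :: "('a, 'r) ring_scheme \<Rightarrow> ('a, 'm, 'e) module_scheme \<Rightarrow> bool" where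
  "free_module R M \<longleftrightarrow>
     module R M \<and>
     (\<exists>B. B \<subseteq> carrier M \<and> \<not> module.lin_dep R M B \<and> module.span R M B = carrier M)"

definition S_finite :: "('a, 'r) ring_scheme \<Rightarrow> 'a set \<Rightarrow> ('a, 'm, 'e) module_scheme \<Rightarrow> bool" where
  "S_finite R S M \<longleftrightarrow>
     (\<exists>N s. submodule R N M \<and> fg_module R (M\<lparr>carrier := N\<rparr>) \<and>
            s \<in> S \<and> (\<lambda>m. s \<odot>\<^bsub>M\<^esub> m) ` carrier M \<subseteq> N)"

text \<open>Exactness of \<open>0 \<rightarrow> K \<rightarrow> F \<rightarrow> M \<rightarrow> 0\<close> with maps \<open>i\<close> and \<open>p\<close>; \<open>mod_hom\<close> includes that its
  source and target are \<open>R\<close>-modules.\<close>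

definition short_exact ::
    "('a, 'r) ring_scheme \<Rightarrow> ('a, 'k, 'e1) module_scheme \<Rightarrow> ('a, 'f, 'e2) module_scheme \<Rightarrow>
     ('a, 'm, 'e3) module_scheme \<Rightarrow> ('k \<Rightarrow> 'f) \<Rightarrow> ('f \<Rightarrow> 'm) \<Rightarrow> bool" where
  "short_exact R K F M i p \<longleftrightarrow>
     mod_hom R K F i \<and> mod_hom R F M p \<and>
     inj_on i (carrier K) \<and>
     i ` carrier K = {x \<in> carrier F. p x = \<zero>\<^bsub>M\<^esub>} \<and>
     p ` carrier F = carrier M"

text \<open>
  A HOL definition cannot quantify over the types on which \<open>K\<close> and \<open>F\<close> live, so they range over
  the modules with elements of type \<^typ>\<open>nat \<Rightarrow> 'a\<close>, where \<^typ>\<open>'a\<close> is the type of the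
  elements of \<open>R\<close>.  Every finitely generated module is isomorphic to one of this kind, so
  nothing is lost: see the lemma \<open>S_finitely_presentedI\<close> below, where \<open>K\<close> and \<open>F\<close> have arbitrary
  types.
\<close>

definition S_finitely_presented ::
    "('a, 'r) ring_scheme \<Rightarrow> 'a set \<Rightarrow> ('a, 'm, 'e) module_scheme \<Rightarrow> bool" where
  "S_finitely_presented R S M \<longleftrightarrow>
     (\<exists>(K :: ('a, nat \<Rightarrow> 'a) module) (F :: ('a, nat \<Rightarrow> 'a) module) i p.
        short_exact R K F M i p \<and> S_finite R S K \<and> fg_module R F \<and> free_module R F)"

text \<open>The \<open>R\<close>-module obtained from a module over \<open>R'\<close> along a map \<open>\<phi>\<close> from \<open>R\<close> to \<open>R'\<close>.\<close>

definition restrict_scalars :: "('a \<Rightarrow> 'b) \<Rightarrow> ('b, 'm, 'e) module_scheme \<Rightarrow> ('a, 'm) module" where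
  "restrict_scalars \<phi> M =
     \<lparr>carrier = carrier M, mult = mult M, one = one M, zero = zero M, add = add M,
      smult = (\<lambda>r m. \<phi> r \<odot>\<^bsub>M\<^esub> m)\<rparr>"

definition ideal_module :: "('a, 'r) ring_scheme \<Rightarrow> 'a set \<Rightarrow> ('a, 'a) module" where
  "ideal_module R I =
     \<lparr>carrier = I, mult = mult R, one = one R, zero = zero R, add = add R, smult = mult R\<rparr>"


lemma restrict_scalars_module:
  assumes "ring_hom_cring R R' \<phi>" and "module R' M"
  shows "module R (restrict_scalars \<phi> M)"
proof -
  interpret h: ring_hom_cring R R' \<phi> by fact
  interpret M: module R' M by fact
  show ?thesis
    by (rule module_criteria)
      (auto simp: restrict_scalars_def h.R.is_cring M.a_ac M.smult_l_distr M.smult_r_distr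
        M.smult_assoc1 intro: M.l_neg M.r_neg bexI[of _ "\<ominus>\<^bsub>M\<^esub> _"])
qed

lemma ideal_module_module:
  assumes "cring R" and "ideal I R"
  shows "module R (ideal_module R I)"
proof -
  interpret R: cring R by fact
  interpret I: ideal I R by fact
  show ?thesis
  proof (rule module_criteria, goal_cases)
    case 4
    have "v \<oplus>\<^bsub>R\<^esub> \<ominus>\<^bsub>R\<^esub> v = \<zero>\<^bsub>R\<^esub>" "\<ominus>\<^bsub>R\<^esub> v \<in> I" if "v \<in> I" for v
      using that by (auto simp: R.r_neg I.Icarr)
    then show ?case by (auto simp: ideal_module_def)
  qed (auto simp: ideal_module_def R.is_cring I.Icarr R.a_ac R.l_distr R.r_distr R.m_assoc
        I.I_l_closed)
qed

lemma quotient_submonoid: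
  assumes "cring R" and "ideal I R" and "submonoid S R"
  shows "submonoid ((\<lambda>s. I +>\<^bsub>R\<^esub> s) ` S) (R Quot I)"
proof -
  interpret R: cring R by fact
  interpret I: ideal I R by fact
  interpret S: submonoid S R by fact
  interpret h: ring_hom_cring R "R Quot I" "(+>\<^bsub>R\<^esub>) I"
    by (rule I.rcos_ring_hom_cring) fact
  show ?thesis
  proof
    show "(\<lambda>s. I +>\<^bsub>R\<^esub> s) ` S \<subseteq> carrier (R Quot I)"
      using h.hom_closed S.subset by auto
    show "x \<otimes>\<^bsub>R Quot I\<^esub> y \<in> (\<lambda>s. I +>\<^bsub>R\<^esub> s) ` S"
      if "x \<in> (\<lambda>s. I +>\<^bsub>R\<^esub> s) ` S" "y \<in> (\<lambda>s. I +>\<^bsub>R\<^esub> s) ` S" for x y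
    proof -
      from that obtain s t where st: "s \<in> S" "t \<in> S" "x = I +>\<^bsub>R\<^esub> s" "y = I +>\<^bsub>R\<^esub> t"
        by auto
      then have "x \<otimes>\<^bsub>R Quot I\<^esub> y = I +>\<^bsub>R\<^esub> (s \<otimes>\<^bsub>R\<^esub> t)"
        using h.hom_mult S.subset by auto
      with S.m_closed[OF st(1,2)] show ?thesis by auto
    qed
    show "\<one>\<^bsub>R Quot I\<^esub> \<in> (\<lambda>s. I +>\<^bsub>R\<^esub> s) ` S"
      using h.hom_one S.one_closed by (metis imageI)
  qed
qed


text \<open>Transport of module structure along an injection, used to change the element type.\<close>

definition transport :: "('m \<Rightarrow> 'z) \<Rightarrow> ('a, 'm, 'e) module_scheme \<Rightarrow> ('a, 'z) module" where
  "transport h M =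
     (let g = inv_into (carrier M) h in
      \<lparr>carrier = h ` carrier M, mult = (\<lambda>x y. undefined), one = undefined, zero = h \<zero>\<^bsub>M\<^esub>,
       add = (\<lambda>x y. h (g x \<oplus>\<^bsub>M\<^esub> g y)), smult = (\<lambda>a x. h (a \<odot>\<^bsub>M\<^esub> g x))\<rparr>)"

lemma transport_module:
  assumes "module R M" and inj: "inj_on h (carrier M)"
  shows "module R (transport h M)"
proof -
  interpret M: module R M by fact
  note [simp] = inv_into_f_f[OF inj]
  show ?thesis
  proof (rule module_criteria, goal_cases)
    case 4
    have "v \<oplus>\<^bsub>M\<^esub> \<ominus>\<^bsub>M\<^esub> v = \<zero>\<^bsub>M\<^esub>" "\<ominus>\<^bsub>M\<^esub> v \<in> carrier M" if "v \<in> carrier M" for v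
      using that M.M.r_neg by auto
    then show ?case
      by (auto simp: transport_def Let_def intro!: bexI[of _ "\<ominus>\<^bsub>M\<^esub> _"])
  qed (auto simp: transport_def Let_def M.R.is_cring M.M.a_ac M.smult_l_distr M.smult_r_distr
        M.smult_assoc1)
qed

lemma transport_hom:
  assumes "module R M" and inj: "inj_on h (carrier M)"
  shows "mod_hom R M (transport h M) h"
proof -
  interpret M: module R M by fact
  note [simp] = inv_into_f_f[OF inj]
  show ?thesis
    unfolding mod_hom_def mod_hom_axioms_def module_hom_def
    using assms(1) transport_module[OF assms]
    by (auto simp: transport_def Let_def)
qed

lemma transport_inv_hom:
  assumes "module R M" and inj: "inj_on h (carrier M)"
  shows "mod_hom R (transport h M) M (inv_into (carrier M) h)"
proof -
  interpret M: module R M by fact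
  note [simp] = inv_into_f_f[OF inj]
  show ?thesis
    unfolding mod_hom_def mod_hom_axioms_def module_hom_def
    using assms(1) transport_module[OF assms]
    by (auto simp: transport_def Let_def)
qed

lemma mod_hom_comp:
  assumes "mod_hom R M N f" and "mod_hom R N P g"
  shows "mod_hom R M P (g \<circ> f)"
proof -
  interpret f: mod_hom R M N f by fact
  interpret g: mod_hom R N P g by fact
  show ?thesis
    unfolding mod_hom_def mod_hom_axioms_def module_hom_def
    using f.M.module_axioms g.N.module_axioms by auto
qed

lemma hom_lincomb:
  assumes "mod_hom R M N h" and inj: "inj_on h (carrier M)"
    and A: "A \<subseteq> carrier M" and a: "a \<in> h ` A \<rightarrow> carrier R"
  shows "module.lincomb N a (h ` A) = h (module.lincomb M (a \<circ> h) A)"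
proof -
  interpret h: mod_hom R M N h by fact
  have injA: "inj_on h A" using inj A by (rule inj_on_subset)
  have ha: "a (h v) \<in> carrier R" if "v \<in> A" for v using a that by auto
  have "module.lincomb N a (h ` A) = (\<Oplus>\<^bsub>N\<^esub>v\<in>A. a (h v) \<odot>\<^bsub>N\<^esub> h v)"
    unfolding h.N.lincomb_def using injA ha A
    by (intro h.N.M.finsum_reindex) (auto intro!: h.N.smult_closed)
  also have "\<dots> = (\<Oplus>\<^bsub>N\<^esub>v\<in>A. h (a (h v) \<odot>\<^bsub>M\<^esub> v))"
    using ha A by (intro h.N.M.finsum_cong') (auto intro!: h.N.smult_closed)
  also have "\<dots> = h (\<Oplus>\<^bsub>M\<^esub>v\<in>A. a (h v) \<odot>\<^bsub>M\<^esub> v)"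
    using ha A by (intro h.hom_sum[symmetric]) auto
  finally show ?thesis by (simp add: h.M.lincomb_def)
qed

lemma hom_span:
  assumes "mod_hom R M N h" and inj: "inj_on h (carrier M)" and A: "A \<subseteq> carrier M"
  shows "module.span R N (h ` A) = h ` module.span R M A"
proof -
  interpret h: mod_hom R M N h by fact
  show ?thesis
  proof
    show "module.span R N (h ` A) \<subseteq> h ` module.span R M A"
    proof
      fix y assume "y \<in> module.span R N (h ` A)"
      then obtain a B where B: "y = module.lincomb N a B" "finite B" "B \<subseteq> h ` A"
        "a \<in> B \<rightarrow> carrier R"
        unfolding h.N.span_def by auto
      then obtain C where C: "C \<subseteq> A" "finite C" "B = h ` C"
        by (metis finite_subset_image)
      have "y = h (module.lincomb M (a \<circ> h) C)"
        using B C A by (simp add: hom_lincomb[OF assms(1) inj])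
      moreover have "module.lincomb M (a \<circ> h) C \<in> module.span R M A"
        unfolding h.M.span_def using B C by fastforce
      ultimately show "y \<in> h ` module.span R M A" by blast
    qed
    show "h ` module.span R M A \<subseteq> module.span R N (h ` A)"
    proof
      fix y assume "y \<in> h ` module.span R M A"
      then obtain a C where C: "y = h (module.lincomb M a C)" "finite C" "C \<subseteq> A"
        "a \<in> C \<rightarrow> carrier R"
        unfolding h.M.span_def by auto
      have injC: "inj_on h C" using inj A C by (meson inj_on_subset)
      let ?b = "a \<circ> inv_into C h"
      have b: "?b \<in> h ` C \<rightarrow> carrier R" using C injC by auto
      have "module.lincomb N ?b (h ` C) = h (module.lincomb M (?b \<circ> h) C)"
        using A C b by (intro hom_lincomb[OF assms(1) inj]) auto
      also have "module.lincomb M (?b \<circ> h) C = module.lincomb M a C"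
        using A C injC by (intro h.M.lincomb_cong) auto
      finally have "y = module.lincomb N ?b (h ` C)" using C(1) by metis
      moreover have "finite (h ` C)" "h ` C \<subseteq> h ` A" using C by auto
      ultimately show "y \<in> module.span R N (h ` A)"
        unfolding h.N.span_def using b by blast
    qed
  qed
qed

lemma hom_lin_dep:
  assumes "mod_hom R M N h" and inj: "inj_on h (carrier M)" and A: "A \<subseteq> carrier M"
    and "module.lin_dep R N (h ` A)"
  shows "module.lin_dep R M A"
proof -
  interpret h: mod_hom R M N h by fact
  from assms(4) obtain B a v where B: "finite B" "B \<subseteq> h ` A" "a \<in> B \<rightarrow> carrier R"
    "module.lincomb N a B = \<zero>\<^bsub>N\<^esub>" "v \<in> B" "a v \<noteq> \<zero>\<^bsub>R\<^esub>"
    unfolding h.N.lin_dep_def by blast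
  from B(1,2) obtain C where C: "C \<subseteq> A" "finite C" "B = h ` C"
    by (metis finite_subset_image)
  have CM: "C \<subseteq> carrier M" using A C by auto
  have "h (module.lincomb M (a \<circ> h) C) = h \<zero>\<^bsub>M\<^esub>"
    using B C CM by (simp flip: hom_lincomb[OF assms(1) inj])
  moreover have aC: "a \<circ> h \<in> C \<rightarrow> carrier R" using B C by auto
  ultimately have "module.lincomb M (a \<circ> h) C = \<zero>\<^bsub>M\<^esub>"
    by (intro inj_onD[OF inj] h.M.lincomb_closed[OF CM] h.M.M.zero_closed)
  moreover obtain w where "w \<in> C" "v = h w" using B C by auto
  ultimately show ?thesis
    using B C aC by (intro h.M.lin_dep_crit[of C _ "a \<circ> h" w]) auto
qed

lemma fg_module_iso:
  assumes "mod_hom R M N h" and "inj_on h (carrier M)" and "h ` carrier M = carrier N"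
    and "fg_module R M"
  shows "fg_module R N"
proof -
  interpret h: mod_hom R M N h by fact
  from assms(4) obtain A where A: "finite A" "A \<subseteq> carrier M" "module.span R M A = carrier M"
    unfolding fg_module_def by auto
  then have "module.span R N (h ` A) = carrier N" "h ` A \<subseteq> carrier N" "finite (h ` A)"
    using hom_span[OF assms(1,2), of A] assms(3) by auto
  then show ?thesis unfolding fg_module_def using h.N.module_axioms by blast
qed

lemma free_module_iso:
  assumes "mod_hom R M N h" and "inj_on h (carrier M)" and "h ` carrier M = carrier N"
    and "free_module R M"
  shows "free_module R N"
proof -
  interpret h: mod_hom R M N h by fact
  from assms(4) obtain B where B: "B \<subseteq> carrier M" "\<not> module.lin_dep R M B"
    "module.span R M B = carrier M"
    unfolding free_module_def by auto
  then have "module.span R N (h ` B) = carrier N" "h ` B \<subseteq> carrier N"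
    "\<not> module.lin_dep R N (h ` B)"
    using hom_span[OF assms(1,2), of B] hom_lin_dep[OF assms(1,2), of B] assms(3) by auto
  then show ?thesis unfolding free_module_def using h.N.module_axioms by blast
qed

lemma S_finite_iso:
  assumes "mod_hom R M N h" and inj: "inj_on h (carrier M)" and surj: "h ` carrier M = carrier N"
    and S: "S \<subseteq> carrier R" and "S_finite R S M"
  shows "S_finite R S N"
proof -
  interpret h: mod_hom R M N h by fact
  from assms(5) obtain L s where L: "submodule R L M" "fg_module R (M\<lparr>carrier := L\<rparr>)" "s \<in> S"
    "(\<lambda>m. s \<odot>\<^bsub>M\<^esub> m) ` carrier M \<subseteq> L"
    unfolding S_finite_def by auto
  have LM: "L \<subseteq> carrier M" using L(1) by (simp add: submodule_def)
  interpret L: module R "M\<lparr>carrier := L\<rparr>" using L(1) by (rule h.M.submodule_is_module)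
  have "mod_hom R (M\<lparr>carrier := L\<rparr>) N h"
    unfolding mod_hom_def mod_hom_axioms_def module_hom_def
    using L.module_axioms h.N.module_axioms LM by (auto simp: subset_iff)
  then have "submodule R (mod_hom.im (M\<lparr>carrier := L\<rparr>) h) N"
    by (rule mod_hom.im_is_submodule)
  also have "mod_hom.im (M\<lparr>carrier := L\<rparr>) h = h ` L"
    using \<open>mod_hom R (M\<lparr>carrier := L\<rparr>) N h\<close> by (simp add: mod_hom.im_def)
  finally have sub: "submodule R (h ` L) N" .
  interpret L': module R "N\<lparr>carrier := h ` L\<rparr>" using sub by (rule h.N.submodule_is_module)
  have "mod_hom R (M\<lparr>carrier := L\<rparr>) (N\<lparr>carrier := h ` L\<rparr>) h"
    unfolding mod_hom_def mod_hom_axioms_def module_hom_def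
    using L.module_axioms L'.module_axioms LM by (auto simp: subset_iff)
  then have fg: "fg_module R (N\<lparr>carrier := h ` L\<rparr>)"
    by (rule fg_module_iso) (use L(2) inj LM in \<open>auto intro: inj_on_subset\<close>)
  have "s \<odot>\<^bsub>N\<^esub> h m \<in> h ` L" if "m \<in> carrier M" for m
    using that L(3,4) S h.f_smult[of s m] by (metis image_subset_iff imageI subsetD)
  then have "(\<lambda>m. s \<odot>\<^bsub>N\<^esub> m) ` carrier N \<subseteq> h ` L"
    by (simp add: surj[symmetric] image_subset_iff)
  with sub fg L(3) show ?thesis unfolding S_finite_def by blast
qed

lemma fg_module_inj_nat:
  fixes R :: "('a, 'r) ring_scheme" and M :: "('a, 'm, 'e) module_scheme"
  assumes "fg_module R M"
  obtains h :: "'m \<Rightarrow> nat \<Rightarrow> 'a" where "inj_on h (carrier M)"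
proof -
  interpret M: module R M using assms by (simp add: fg_module_def)
  from assms obtain A where A: "finite A" "A \<subseteq> carrier M" "M.span A = carrier M"
    unfolding fg_module_def by auto
  from A(1) obtain b and n :: nat where b: "A = b ` {i. i < n}"
    by (metis finite_imp_nat_seg_image_inj_on)
  have "\<exists>a. a \<in> A \<rightarrow> carrier R \<and> M.lincomb a A = x" if "x \<in> carrier M" for x
    using M.finite_in_span[of A x] A that by auto
  then obtain c where c: "\<And>x. x \<in> carrier M \<Longrightarrow> c x \<in> A \<rightarrow> carrier R \<and> M.lincomb (c x) A = x"
    by metis
  have "inj_on (\<lambda>x i. c x (b i)) (carrier M)"
  proof (rule inj_onI)
    fix x y assume xy: "x \<in> carrier M" "y \<in> carrier M" "(\<lambda>i. c x (b i)) = (\<lambda>i. c y (b i))"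
    then have "M.lincomb (c x) A = M.lincomb (c y) A"
      using A c b by (intro M.lincomb_cong) (auto dest: fun_cong)
    with xy c show "x = y" by metis
  qed
  then show thesis by (rule that)
qed

lemma S_finitely_presentedI:
  fixes R :: "('a, 'r) ring_scheme" and K :: "('a, 'k, 'e1) module_scheme"
    and F :: "('a, 'f, 'e2) module_scheme" and M :: "('a, 'm, 'e3) module_scheme"
  assumes S: "S \<subseteq> carrier R"
    and ex: "short_exact R K F M i p"
    and fin: "S_finite R S K" and fg: "fg_module R F" and free: "free_module R F"
  shows "S_finitely_presented R S M"
proof -
  obtain h :: "'f \<Rightarrow> nat \<Rightarrow> 'a" where h: "inj_on h (carrier F)"
    using fg by (rule fg_module_inj_nat)
  interpret i: mod_hom R K F i using ex by (simp add: short_exact_def)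
  interpret p: mod_hom R F M p using ex by (simp add: short_exact_def)
  have iK: "inj_on i (carrier K)" "i ` carrier K = {x \<in> carrier F. p x = \<zero>\<^bsub>M\<^esub>}"
    and pF: "p ` carrier F = carrier M"
    using ex by (auto simp: short_exact_def)
  let ?k = "h \<circ> i"
  let ?F = "transport h F" and ?K = "transport ?k K"
  let ?i = "h \<circ> (i \<circ> inv_into (carrier K) ?k)" and ?p = "p \<circ> inv_into (carrier F) h"
  have k: "inj_on ?k (carrier K)"
    using iK h by (intro comp_inj_on) (auto intro: inj_on_subset)
  note F = transport_hom[OF i.N.module_axioms h] transport_inv_hom[OF i.N.module_axioms h]
  note K = transport_hom[OF i.M.module_axioms k] transport_inv_hom[OF i.M.module_axioms k]
  have cF: "carrier ?F = h ` carrier F" and cK: "carrier ?K = ?k ` carrier K"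
    by (simp_all add: transport_def Let_def)
  note [simp] = inv_into_f_f[OF h] inv_into_f_f[OF k, unfolded comp_def]
  have i_id: "?i y = y" if "y \<in> carrier ?K" for y
    using f_inv_into_f[of y ?k "carrier K"] that by (simp add: cK)
  have "short_exact R ?K ?F M ?i ?p"
    unfolding short_exact_def
  proof (intro conjI)
    show "mod_hom R ?K ?F ?i"
      by (intro mod_hom_comp[OF _ F(1)] mod_hom_comp[OF K(2)]) unfold_locales
    show "mod_hom R ?F M ?p"
      by (intro mod_hom_comp[OF F(2)]) unfold_locales
    show "inj_on ?i (carrier ?K)"
      using i_id by (auto intro!: inj_onI)
    have "?i ` carrier ?K = carrier ?K" using i_id by force
    also have "\<dots> = h ` {x \<in> carrier F. p x = \<zero>\<^bsub>M\<^esub>}"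
      by (simp only: cK iK(2)[symmetric] image_comp)
    also have "\<dots> = {x \<in> carrier ?F. ?p x = \<zero>\<^bsub>M\<^esub>}"
      by (auto simp: cF)
    finally show "?i ` carrier ?K = {x \<in> carrier ?F. ?p x = \<zero>\<^bsub>M\<^esub>}" .
    have "?p ` carrier ?F = p ` carrier F"
      by (force simp: cF)
    with pF show "?p ` carrier ?F = carrier M" by simp
  qed
  moreover have "S_finite R S ?K"
    using S_finite_iso[OF K(1) k _ S fin] cK by simp
  moreover have "fg_module R ?F" "free_module R ?F"
    using fg_module_iso[OF F(1) h _ fg] free_module_iso[OF F(1) h _ free] cF by simp_all
  ultimately show ?thesis
    unfolding S_finitely_presented_def by blast
qed

end

(* Any finitely generated free module is R^A for a finite set A, so a finite presentation amounts to
   a finite generating family of M together with its module of relations in R^A.  The same family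
   serves M over R and over R/I, and reducing coefficients modulo I gives an exact sequence
   0 -> I^A -> Rel_R -> Rel_{R/I} -> 0 of R-modules.  S-finiteness passes to quotients, which yields
   the descent; it also passes to extensions, and I^A is S-finite when I is, which yields the
   converse. *)
theory Submission
  imports Defs
begin

section \<open>S-finite modules and homomorphisms\<close>

text \<open>Part 1 is applied not only to M but also to the relation module over R/I, and there it
  is the bridge for both directions of part 2: S-finiteness over R and T-finiteness over R/I are the
  same property of that module. It rests on surjectivity of R -> R/I, which gives an R/I-module the
  same submodules over both rings. Coordinates are used because a free module is only known to have
  some basis, while R^A can be reduced modulo I entry by entry, without forming F/IF or a tensor
  product. The kernel of the reduction is all of I^A because I annihilates M, so that every tuple
  with entries in I is a relation. Disjointness of I and S enters as 1 not in I: both rings are then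
  nontrivial, which keeps unit vectors distinct and drives the argument that bases are
  finite.\<close>

lemma mod_homI:
  assumes "module R M" and "module R N"
    and "\<And>x. x \<in> carrier M \<Longrightarrow> f x \<in> carrier N"
    and "\<And>x y. x \<in> carrier M \<Longrightarrow> y \<in> carrier M \<Longrightarrow> f (x \<oplus>\<^bsub>M\<^esub> y) = f x \<oplus>\<^bsub>N\<^esub> f y"
    and "\<And>r x. r \<in> carrier R \<Longrightarrow> x \<in> carrier M \<Longrightarrow> f (r \<odot>\<^bsub>M\<^esub> x) = r \<odot>\<^bsub>N\<^esub> f x"
  shows "mod_hom R M N f"
  using assms by (auto simp: mod_hom_def mod_hom_axioms_def module_hom_def)

lemma (in mod_hom) vimage_submodule:
  assumes "submodule R L N"
  shows "submodule R {x \<in> carrier M. f x \<in> L} M"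
proof -
  interpret L: submodule R L N by fact
  show ?thesis by unfold_locales auto
qed

lemma (in mod_hom) image_submodule:
  assumes "submodule R L M"
  shows "submodule R (f ` L) N"
proof -
  interpret L: submodule R L M by fact
  have L: "x \<in> carrier M" if "x \<in> L" for x using L.subset that by auto
  show ?thesis
  proof (rule submodule.intro)
    show "v \<oplus>\<^bsub>N\<^esub> w \<in> f ` L" if vw: "v \<in> f ` L" "w \<in> f ` L" for v w
    proof -
      from vw obtain x y where "x \<in> L" "y \<in> L" "v = f x" "w = f y" by blast
      then show ?thesis using L f_add[of x y] L.m_closed[of x y] by (metis imageI)
    qed
    show "\<zero>\<^bsub>N\<^esub> \<in> f ` L" using f0_is_0 L.zero_closed by (metis imageI)
    show "c \<odot>\<^bsub>N\<^esub> v \<in> f ` L" if c: "c \<in> carrier R" and v: "v \<in> f ` L" for c v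
    proof -
      from v obtain x where "x \<in> L" "v = f x" by blast
      then show ?thesis using L c f_smult[of c x] L.smult_closed[of c x] by (metis imageI)
    qed
  qed (use L N.module_axioms in auto)
qed

text \<open>Since \<open>f\<close> may identify elements, coefficients are not transported. A span
  is the least submodule containing its generators, so images and preimages of submodules give the
  two inclusions.\<close>

lemma (in mod_hom) span_image:
  assumes A: "A \<subseteq> carrier M"
  shows "N.span (f ` A) = f ` M.span A"
proof
  have "f ` A \<subseteq> f ` M.span A" using M.in_own_span[OF A] by auto
  then show "N.span (f ` A) \<subseteq> f ` M.span A"
    by (rule N.span_is_subset) (intro image_submodule M.span_is_submodule A)
  have fA: "f ` A \<subseteq> carrier N" using A by auto
  have "M.span A \<subseteq> {x \<in> carrier M. f x \<in> N.span (f ` A)}"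
    using A N.in_own_span[OF fA]
    by (intro M.span_is_subset vimage_submodule N.span_is_submodule fA) auto
  then show "f ` M.span A \<subseteq> N.span (f ` A)" by auto
qed

lemma (in mod_hom) restrict_hom:
  assumes L: "submodule R L M" and P: "submodule R P N" and "f ` L \<subseteq> P"
  shows "mod_hom R (M\<lparr>carrier := L\<rparr>) (N\<lparr>carrier := P\<rparr>) f"
proof (rule mod_homI)
  have "x \<in> carrier M" if "x \<in> L" for x using submodule.subset[OF L] that by auto
  then show "f (x \<oplus>\<^bsub>M\<lparr>carrier := L\<rparr>\<^esub> y) = f x \<oplus>\<^bsub>N\<lparr>carrier := P\<rparr>\<^esub> f y"
    if "x \<in> carrier (M\<lparr>carrier := L\<rparr>)" "y \<in> carrier (M\<lparr>carrier := L\<rparr>)" for x y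
    using that by simp
  show "f (r \<odot>\<^bsub>M\<lparr>carrier := L\<rparr>\<^esub> x) = r \<odot>\<^bsub>N\<lparr>carrier := P\<rparr>\<^esub> f x"
    if "r \<in> carrier R" "x \<in> carrier (M\<lparr>carrier := L\<rparr>)" for r x
    using that submodule.subset[OF L] by auto
qed (use assms in \<open>auto intro: M.submodule_is_module N.submodule_is_module\<close>)

lemma mod_hom_inv_into:
  assumes "mod_hom R M N f" and bij: "bij_betw f (carrier M) (carrier N)"
  shows "mod_hom R N M (inv_into (carrier M) f)"
proof -
  interpret f: mod_hom R M N f by fact
  have inj: "inj_on f (carrier M)" and surj: "f ` carrier M = carrier N"
    using bij by (auto simp: bij_betw_def)
  let ?g = "inv_into (carrier M) f"
  have g: "?g y \<in> carrier M" "f (?g y) = y" if "y \<in> carrier N" for y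
    using that surj by (simp_all add: inv_into_into f_inv_into_f)
  have gf: "?g y = x" if "x \<in> carrier M" "f x = y" for x y
    using that inj by auto
  show ?thesis
    by (rule mod_homI) (auto simp: f.M.module_axioms f.N.module_axioms g intro!: gf)
qed

text \<open>Replacing \<open>N\<close> by the span of finitely many elements keeps all computation
  in \<open>M\<close>: spans taken in the record with the smaller carrier agree with spans in
  \<open>M\<close>.\<close>

lemma S_finite_iff:
  assumes "module R M"
  shows "S_finite R S M \<longleftrightarrow>
    (\<exists>A s. finite A \<and> A \<subseteq> carrier M \<and> s \<in> S \<and> (\<forall>m \<in> carrier M. s \<odot>\<^bsub>M\<^esub> m \<in> module.span R M A))"
proof -
  interpret M: module R M by fact
  show ?thesis
  proof
    assume "S_finite R S M"
    then obtain N s A where N: "submodule R N M" "s \<in> S" "(\<lambda>m. s \<odot>\<^bsub>M\<^esub> m) ` carrier M \<subseteq> N"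
      "finite A" "A \<subseteq> N" "module.span R (M\<lparr>carrier := N\<rparr>) A = N"
      unfolding S_finite_def fg_module_def by auto
    moreover have "M.span A = N" using N M.span_li_not_depend(1)[OF N(5,1)] by simp
    moreover have "A \<subseteq> carrier M" using submodule.subset[OF N(1)] N(5) by blast
    ultimately show "\<exists>A s. finite A \<and> A \<subseteq> carrier M \<and> s \<in> S \<and>
        (\<forall>m \<in> carrier M. s \<odot>\<^bsub>M\<^esub> m \<in> M.span A)"
      by (intro exI[of _ A] exI[of _ s]) (simp add: image_subset_iff)
  next
    assume "\<exists>A s. finite A \<and> A \<subseteq> carrier M \<and> s \<in> S \<and> (\<forall>m \<in> carrier M. s \<odot>\<^bsub>M\<^esub> m \<in> M.span A)"
    then obtain A s where A: "finite A" "A \<subseteq> carrier M" "s \<in> S"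
      "\<forall>m \<in> carrier M. s \<odot>\<^bsub>M\<^esub> m \<in> M.span A"
      by blast
    have sub: "submodule R (M.span A) M" by (rule M.span_is_submodule) fact
    have "fg_module R (M\<lparr>carrier := M.span A\<rparr>)"
      unfolding fg_module_def
      using M.submodule_is_module[OF sub] A(1) M.in_own_span[OF A(2)]
        M.span_li_not_depend(1)[OF M.in_own_span[OF A(2)] sub]
      by (intro conjI exI[of _ A]) simp_all
    then show "S_finite R S M"
      unfolding S_finite_def using A(3,4) sub
      by (intro exI[of _ "M.span A"] exI[of _ s]) (simp add: image_subset_iff)
  qed
qed

lemma S_finite_image:
  assumes "mod_hom R M N f" and surj: "f ` carrier M = carrier N" and S: "S \<subseteq> carrier R"
    and "S_finite R S M"
  shows "S_finite R S N"
proof -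
  interpret f: mod_hom R M N f by fact
  from assms(4) obtain A s where A: "finite A" "A \<subseteq> carrier M" "s \<in> S"
    "\<forall>m \<in> carrier M. s \<odot>\<^bsub>M\<^esub> m \<in> f.M.span A"
    unfolding S_finite_iff[OF f.M.module_axioms] by blast
  have "s \<odot>\<^bsub>N\<^esub> f m \<in> f.N.span (f ` A)" if "m \<in> carrier M" for m
  proof -
    have "f (s \<odot>\<^bsub>M\<^esub> m) = s \<odot>\<^bsub>N\<^esub> f m" using S A(3) that by (intro f.f_smult) auto
    then show ?thesis using A that unfolding f.span_image[OF A(2)] by (metis imageI)
  qed
  then show ?thesis
    unfolding S_finite_iff[OF f.N.module_axioms] surj[symmetric] using A
    by (intro exI[of _ "f ` A"] exI[of _ s]) auto
qed

text \<open>If \<open>A\<close> and \<open>t\<close> serve the kernel, and \<open>s\<close> together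
  with the images of \<open>D\<close> serves \<open>N\<close>, then the union of \<open>A\<close>
  and \<open>D\<close> and the product of \<open>t\<close> and \<open>s\<close> serve
  \<open>M\<close>: \<open>s m\<close> differs from an element of the span of \<open>D\<close> by a
  kernel element, which \<open>t\<close> moves into the span of \<open>A\<close>.\<close>

lemma S_finite_extension:
  assumes "mod_hom R M N f" and surj: "f ` carrier M = carrier N" and "submonoid S R"
    and kerf: "S_finite R S (M\<lparr>carrier := {x \<in> carrier M. f x = \<zero>\<^bsub>N\<^esub>}\<rparr>)" and "S_finite R S N"
  shows "S_finite R S M"
proof -
  interpret f: mod_hom R M N f by fact
  interpret S: submonoid S R by fact
  let ?K = "{x \<in> carrier M. f x = \<zero>\<^bsub>N\<^esub>}"
  have K: "submodule R ?K M" using f.ker_is_submodule by (simp add: f.ker_def)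
  from kerf obtain A t where A: "finite A" "A \<subseteq> ?K" "t \<in> S"
    "\<forall>m \<in> ?K. t \<odot>\<^bsub>M\<^esub> m \<in> module.span R (M\<lparr>carrier := ?K\<rparr>) A"
    unfolding S_finite_iff[OF f.M.submodule_is_module[OF K]] by auto
  from assms(5) obtain C s where "finite C" "C \<subseteq> f ` carrier M" and s: "s \<in> S"
    "\<forall>m \<in> carrier N. s \<odot>\<^bsub>N\<^esub> m \<in> f.N.span C"
    unfolding S_finite_iff[OF f.N.module_axioms] surj by blast
  then obtain D where D: "finite D" "D \<subseteq> carrier M" "C = f ` D"
    by (metis finite_subset_image)
  have AM: "A \<union> D \<subseteq> carrier M" using A D by auto
  have st: "s \<in> carrier R" "t \<in> carrier R" using s A S.subset by auto
  interpret U: submodule R "f.M.span (A \<union> D)" M by (rule f.M.span_is_submodule) fact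
  have "(t \<otimes>\<^bsub>R\<^esub> s) \<odot>\<^bsub>M\<^esub> m \<in> f.M.span (A \<union> D)" if m: "m \<in> carrier M" for m
  proof -
    have "s \<odot>\<^bsub>N\<^esub> f m \<in> f ` f.M.span D"
      using s m D f.span_image[OF D(2)] by auto
    then obtain u where u: "u \<in> f.M.span D" "f u = s \<odot>\<^bsub>N\<^esub> f m" by force
    have uM: "u \<in> carrier M" using u f.M.span_is_subset2[OF D(2)] by auto
    have "s \<odot>\<^bsub>M\<^esub> m \<ominus>\<^bsub>M\<^esub> u \<in> ?K"
      using m uM u st by (simp add: f.N.M.r_neg f.N.M.minus_eq)
    then have "t \<odot>\<^bsub>M\<^esub> (s \<odot>\<^bsub>M\<^esub> m \<ominus>\<^bsub>M\<^esub> u) \<in> f.M.span A"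
      using A f.M.span_li_not_depend(1)[OF A(2) K] by auto
    then have 1: "t \<odot>\<^bsub>M\<^esub> (s \<odot>\<^bsub>M\<^esub> m \<ominus>\<^bsub>M\<^esub> u) \<in> f.M.span (A \<union> D)"
      using f.M.span_is_monotone[of A "A \<union> D"] by blast
    have 2: "t \<odot>\<^bsub>M\<^esub> u \<in> f.M.span (A \<union> D)"
      using st u f.M.span_is_monotone[of D "A \<union> D"] by blast
    have "s \<odot>\<^bsub>M\<^esub> m = (s \<odot>\<^bsub>M\<^esub> m \<ominus>\<^bsub>M\<^esub> u) \<oplus>\<^bsub>M\<^esub> u"
      using st m uM by (simp add: f.M.M.minus_eq f.M.M.a_assoc f.M.M.l_neg)
    then have "(t \<otimes>\<^bsub>R\<^esub> s) \<odot>\<^bsub>M\<^esub> m = t \<odot>\<^bsub>M\<^esub> (s \<odot>\<^bsub>M\<^esub> m \<ominus>\<^bsub>M\<^esub> u) \<oplus>\<^bsub>M\<^esub> t \<odot>\<^bsub>M\<^esub> u"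
      using st m uM by (metis f.M.smult_assoc1 f.M.smult_r_distr f.M.M.minus_closed f.M.smult_closed)
    then show ?thesis using 1 2 by simp
  qed
  moreover have "t \<otimes>\<^bsub>R\<^esub> s \<in> S" using A s by blast
  ultimately show ?thesis
    unfolding S_finite_iff[OF f.M.module_axioms] using A D AM
    by (intro exI[of _ "A \<union> D"] exI[of _ "t \<otimes>\<^bsub>R\<^esub> s"]) auto
qed

section \<open>Restriction of scalars\<close>

lemma restrict_scalars_sel [simp]:
  "carrier (restrict_scalars \<phi> M) = carrier M"
  "zero (restrict_scalars \<phi> M) = zero M"
  "add (restrict_scalars \<phi> M) = add M"
  "r \<odot>\<^bsub>restrict_scalars \<phi> M\<^esub> m = \<phi> r \<odot>\<^bsub>M\<^esub> m"
  by (simp_all add: restrict_scalars_def)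

lemma restrict_scalars_carrier_update:
  "(restrict_scalars \<phi> M)\<lparr>carrier := N\<rparr> = restrict_scalars \<phi> (M\<lparr>carrier := N\<rparr>)"
  by (simp add: restrict_scalars_def)

lemma finsum_restrict_scalars:
  "finsum (restrict_scalars \<phi> M) = finsum M"
  by (intro ext) (simp add: finsum_def finprod_def)

text \<open>The quotient map enters only as a surjective ring homomorphism, which keeps cosets out
  of the arguments; its kernel takes the role of \<open>I\<close>. The locale is instantiated with
  \<open>M\<close> and again with function spaces and relation modules over
  \<open>R'\<close>.\<close>

locale surj_scalar_hom = ring_hom_cring R R' \<phi> + M: module R' M
  for R (structure) and R' (structure) and \<phi> and M (structure) +
  assumes surj: "\<phi> ` carrier R = carrier R'"
begin

lemma module_restrict: "module R (restrict_scalars \<phi> M)"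
  by (rule restrict_scalars_module) unfold_locales

sublocale rM: module R "restrict_scalars \<phi> M"
  by (rule module_restrict)

text \<open>Every scalar of \<open>R'\<close> is \<open>\<phi> r\<close> for some \<open>r\<close>,
  so closure under one ring of scalars is closure under the other.\<close>

lemma submodule_restrict_scalars_iff:
  "submodule R N (restrict_scalars \<phi> M) \<longleftrightarrow> submodule R' N M"
  using module_restrict M.module_axioms by (simp add: submodule_def flip: surj) blast

text \<open>Both spans are the least submodule containing \<open>A\<close>, taken among the same
  submodules.\<close>

lemma span_restrict_scalars:
  assumes A: "A \<subseteq> carrier M"
  shows "rM.span A = M.span A"
proof
  have A': "A \<subseteq> carrier (restrict_scalars \<phi> M)" using A by simp
  show "rM.span A \<subseteq> M.span A"
    using M.in_own_span[OF A] M.span_is_submodule[OF A]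
    by (intro rM.span_is_subset) (simp_all add: submodule_restrict_scalars_iff)
  show "M.span A \<subseteq> rM.span A"
    using rM.in_own_span[OF A'] rM.span_is_submodule[OF A']
    by (intro M.span_is_subset) (simp_all add: submodule_restrict_scalars_iff)
qed

text \<open>The scalars \<open>s\<close> and \<open>\<phi> s\<close> act identically and the spans
  coincide, so the same generators and multiplier work on both sides. Besides giving part 1, this is
  what is applied to relation modules.\<close>

lemma S_finite_restrict_scalars_iff:
  "S_finite R S (restrict_scalars \<phi> M) \<longleftrightarrow> S_finite R' (\<phi> ` S) M"
proof -
  have "S_finite R S (restrict_scalars \<phi> M) \<longleftrightarrow>
      (\<exists>A s. finite A \<and> A \<subseteq> carrier M \<and> s \<in> S \<and> (\<forall>m \<in> carrier M. \<phi> s \<odot>\<^bsub>M\<^esub> m \<in> M.span A))"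
    unfolding S_finite_iff[OF module_restrict] using span_restrict_scalars
    by (intro ex_cong1 conj_cong) simp_all
  then show ?thesis
    unfolding S_finite_iff[OF M.module_axioms] by blast
qed

end

section \<open>Presentations by families of generators\<close>

text \<open>An infinite \<open>A\<close> is covered because the sum is then zero by
  convention.\<close>

lemma (in module) submodule_finsum_closed:
  assumes "submodule R N M" and "f \<in> A \<rightarrow> N"
  shows "(\<Oplus>\<^bsub>M\<^esub>i\<in>A. f i) \<in> N"
proof -
  interpret N: submodule R N M by fact
  show ?thesis using assms(2)
  proof (induct A rule: infinite_finite_induct)
    case (insert i A)
    then have "f \<in> A \<rightarrow> carrier M" "f i \<in> carrier M" using N.subset by auto
    then show ?case using insert by simp
  qed simp_all
qed

section \<open>The free module on a finite set and its relation submodules\<close>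

lemma (in ring) func_space_sel [simp]:
  "carrier (func_space A) = A \<rightarrow>\<^sub>E carrier R"
  "\<zero>\<^bsub>func_space A\<^esub> = (\<lambda>i\<in>A. \<zero>)"
  "c \<oplus>\<^bsub>func_space A\<^esub> d = (\<lambda>i\<in>A. c i \<oplus> d i)"
  "r \<odot>\<^bsub>func_space A\<^esub> c = (\<lambda>i\<in>A. r \<otimes> c i)"
  by (simp_all add: func_space_def)

lemma (in cring) finsum_func_space:
  assumes "f \<in> J \<rightarrow> (A \<rightarrow>\<^sub>E carrier R)" and a: "a \<in> A" and "finite J"
  shows "(\<Oplus>\<^bsub>func_space A\<^esub>j\<in>J. f j) a = (\<Oplus>j\<in>J. f j a)"
  using assms(3,1)
proof (induct J rule: finite_induct)
  case empty
  interpret F: module R "func_space A" by (rule func_space_is_module)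
  show ?case using a by simp
next
  case (insert j J)
  interpret F: module R "func_space A" by (rule func_space_is_module)
  have "f \<in> J \<rightarrow> carrier (func_space A)" "f j \<in> carrier (func_space A)"
    using insert by auto
  then have "(\<Oplus>\<^bsub>func_space A\<^esub>i\<in>insert j J. f i) = f j \<oplus>\<^bsub>func_space A\<^esub> (\<Oplus>\<^bsub>func_space A\<^esub>i\<in>J. f i)"
    using insert.hyps by (intro F.M.finsum_insert)
  moreover have "(\<lambda>i. f i a) \<in> J \<rightarrow> carrier R" "f j a \<in> carrier R"
    using insert.prems a by auto
  ultimately show ?case using insert a by simp
qed

text \<open>A family is used rather than \<open>lincomb\<close> over a subset of \<open>M\<close>:
  distinct basis elements of \<open>F\<close> may have equal images in \<open>M\<close>, and the
  index set must stay fixed when the ring changes.\<close>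

definition family_comb :: "('a, 'm, 'e) module_scheme \<Rightarrow> 'i set \<Rightarrow> ('i \<Rightarrow> 'm) \<Rightarrow> ('i \<Rightarrow> 'a) \<Rightarrow> 'm"
  where "family_comb M A x c = (\<Oplus>\<^bsub>M\<^esub>i\<in>A. c i \<odot>\<^bsub>M\<^esub> x i)"

text \<open>The first syzygy module of the family \<open>x\<close>, in coordinates.\<close>

definition relations ::
  "('a, 'r) ring_scheme \<Rightarrow> ('a, 'm, 'e) module_scheme \<Rightarrow> 'i set \<Rightarrow> ('i \<Rightarrow> 'm) \<Rightarrow> ('i \<Rightarrow> 'a) set"
  where "relations R M A x = {c \<in> A \<rightarrow>\<^sub>E carrier R. family_comb M A x c = \<zero>\<^bsub>M\<^esub>}"

definition unit_vec :: "('a, 'r) ring_scheme \<Rightarrow> 'i set \<Rightarrow> 'i \<Rightarrow> 'i \<Rightarrow> 'a"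
  where "unit_vec R A i = (\<lambda>j\<in>A. if j = i then \<one>\<^bsub>R\<^esub> else \<zero>\<^bsub>R\<^esub>)"

lemma (in module) family_comb_hom:
  assumes x: "x \<in> A \<rightarrow> carrier M" and A: "finite A"
  shows "mod_hom R (func_space A) M (family_comb M A x)"
proof (rule mod_homI)
  have cx: "c i \<odot>\<^bsub>M\<^esub> x i \<in> carrier M" if "c \<in> A \<rightarrow>\<^sub>E carrier R" "i \<in> A" for c i
    using that x by auto
  show "family_comb M A x c \<in> carrier M" if "c \<in> carrier (func_space A)" for c
    using that cx by (auto simp: family_comb_def intro!: M.finsum_closed)
  show "family_comb M A x (c \<oplus>\<^bsub>func_space A\<^esub> d) = family_comb M A x c \<oplus>\<^bsub>M\<^esub> family_comb M A x d"
    if "c \<in> carrier (func_space A)" "d \<in> carrier (func_space A)" for c d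
  proof -
    have cd: "c \<in> A \<rightarrow>\<^sub>E carrier R" "d \<in> A \<rightarrow>\<^sub>E carrier R" using that by simp_all
    then have cd': "c i \<in> carrier R" "d i \<in> carrier R" "x i \<in> carrier M" if "i \<in> A" for i
      using that x by auto
    have "family_comb M A x (c \<oplus>\<^bsub>func_space A\<^esub> d) = (\<Oplus>\<^bsub>M\<^esub>i\<in>A. c i \<odot>\<^bsub>M\<^esub> x i \<oplus>\<^bsub>M\<^esub> d i \<odot>\<^bsub>M\<^esub> x i)"
      unfolding family_comb_def
      by (intro M.finsum_cong' refl) (auto simp: smult_l_distr cd')
    also have "\<dots> = family_comb M A x c \<oplus>\<^bsub>M\<^esub> family_comb M A x d"
      unfolding family_comb_def using cd cx by (intro M.finsum_addf) auto
    finally show ?thesis .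
  qed
  show "family_comb M A x (r \<odot>\<^bsub>func_space A\<^esub> c) = r \<odot>\<^bsub>M\<^esub> family_comb M A x c"
    if "r \<in> carrier R" "c \<in> carrier (func_space A)" for r c
  proof -
    have c: "c \<in> A \<rightarrow>\<^sub>E carrier R" using that by simp
    then have c': "c i \<in> carrier R" "x i \<in> carrier M" if "i \<in> A" for i
      using that x by auto
    have "family_comb M A x (r \<odot>\<^bsub>func_space A\<^esub> c) = (\<Oplus>\<^bsub>M\<^esub>i\<in>A. r \<odot>\<^bsub>M\<^esub> (c i \<odot>\<^bsub>M\<^esub> x i))"
      unfolding family_comb_def using that(1)
      by (intro M.finsum_cong' refl) (auto simp: smult_assoc1 c')
    also have "\<dots> = r \<odot>\<^bsub>M\<^esub> family_comb M A x c"
      unfolding family_comb_def using that(1) c cx A by (intro finsum_smult[symmetric]) auto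
    finally show ?thesis .
  qed
qed (rule func_space_is_module module_axioms)+

lemma (in module) relations_submodule:
  assumes "x \<in> A \<rightarrow> carrier M" and "finite A"
  shows "submodule R (relations R M A x) (func_space A)"
proof -
  interpret p: mod_hom R "func_space A" M "family_comb M A x"
    using assms by (rule family_comb_hom)
  show ?thesis using p.ker_is_submodule by (simp add: p.ker_def relations_def)
qed

section \<open>Unit vectors as a basis of a function space\<close>

context cring
begin

lemma unit_vec_closed [simp]: "unit_vec R A i \<in> A \<rightarrow>\<^sub>E carrier R"
  by (simp add: unit_vec_def)

lemma unit_vec_inj:
  assumes "\<one> \<noteq> \<zero>"
  shows "inj_on (unit_vec R A) A"
proof (rule inj_onI)
  fix i j assume i: "i \<in> A" and eq: "unit_vec R A i = unit_vec R A j"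
  have "unit_vec R A i i = unit_vec R A j i" by (simp only: eq)
  with i assms show "i = j" by (simp add: unit_vec_def split: if_splits)
qed

lemma family_comb_unit_vec:
  assumes "finite A" and c: "c \<in> A \<rightarrow>\<^sub>E carrier R"
  shows "family_comb (func_space A) A (unit_vec R A) c = c"
proof
  interpret F: module R "func_space A" by (rule func_space_is_module)
  have "c i \<odot>\<^bsub>func_space A\<^esub> unit_vec R A i \<in> carrier (func_space A)" if "i \<in> A" for i
    using that c by (intro F.smult_closed) auto
  then have cl: "(\<lambda>i. c i \<odot>\<^bsub>func_space A\<^esub> unit_vec R A i) \<in> A \<rightarrow> (A \<rightarrow>\<^sub>E carrier R)"
    unfolding func_space_sel(1) by (rule Pi_I)
  have c_closed: "c i \<in> carrier R" if "i \<in> A" for i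
    using c that by (rule PiE_mem)
  fix a
  show "family_comb (func_space A) A (unit_vec R A) c a = c a"
  proof (cases "a \<in> A")
    case True
    have "family_comb (func_space A) A (unit_vec R A) c a =
        (\<Oplus>i\<in>A. (c i \<odot>\<^bsub>func_space A\<^esub> unit_vec R A i) a)"
      unfolding family_comb_def using finsum_func_space[OF cl True assms(1)] .
    also have "\<dots> = (\<Oplus>i\<in>A. if a = i then c i else \<zero>)"
      using True by (intro finsum_cong' refl Pi_I) (auto simp: unit_vec_def c_closed)
    also have "\<dots> = c a"
      using True by (intro finsum_singleton assms(1) Pi_I c_closed)
    finally show ?thesis .
  next
    case False
    \<comment> \<open>Outside \<open>A\<close> both sides are \<open>undefined\<close>, since both
      are extensional on \<open>A\<close>.\<close>
    have "family_comb (func_space A) A (unit_vec R A) c \<in> carrier (func_space A)"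
      unfolding family_comb_def by (rule F.M.finsum_closed) (use cl in simp)
    then show ?thesis using False c by (auto simp: PiE_def extensional_def)
  qed
qed

lemma span_unit_vec:
  assumes "finite A"
  shows "module.span R (func_space A) (unit_vec R A ` A) = A \<rightarrow>\<^sub>E carrier R"
proof -
  interpret F: module R "func_space A" by (rule func_space_is_module)
  have E: "unit_vec R A ` A \<subseteq> carrier (func_space A)" by (simp add: image_subset_iff)
  interpret U: submodule R "F.span (unit_vec R A ` A)" "func_space A"
    using E by (rule F.span_is_submodule)
  have "c \<in> F.span (unit_vec R A ` A)" if c: "c \<in> A \<rightarrow>\<^sub>E carrier R" for c
  proof -
    have "family_comb (func_space A) A (unit_vec R A) c \<in> F.span (unit_vec R A ` A)"
      unfolding family_comb_def
      by (rule F.submodule_finsum_closed[OF U.submodule_axioms])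
        (use c F.in_own_span[OF E] in \<open>auto simp del: func_space_sel\<close>)
    then show ?thesis using family_comb_unit_vec[OF assms c] by simp
  qed
  then show ?thesis using F.span_is_subset2[OF E] by auto
qed

lemma fg_func_space:
  assumes "finite A"
  shows "fg_module R (func_space A)"
  unfolding fg_module_def
  using func_space_is_module assms span_unit_vec[OF assms]
  by (intro conjI exI[of _ "unit_vec R A ` A"]) (simp_all add: image_subset_iff)

lemma free_func_space:
  assumes A: "finite A" and "\<one> \<noteq> \<zero>"
  shows "free_module R (func_space A)"
proof -
  interpret F: module R "func_space A" by (rule func_space_is_module)
  have E: "unit_vec R A ` A \<subseteq> carrier (func_space A)" by (simp add: image_subset_iff)
  have "F.lin_indpt (unit_vec R A ` A)"
  proof (rule F.finite_lin_indpt2)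
    fix a assume a: "a \<in> unit_vec R A ` A \<rightarrow> carrier R"
      "F.lincomb a (unit_vec R A ` A) = \<zero>\<^bsub>func_space A\<^esub>"
    \<comment> \<open>The coefficients of \<open>lincomb\<close> are attached to vectors; reindexing
      by the injective \<open>unit_vec\<close> attaches them to \<open>A\<close>. The combination
      then equals its own coefficient tuple, so it vanishes only if all of them do.\<close>
    let ?c = "\<lambda>i\<in>A. a (unit_vec R A i)"
    have c: "?c \<in> A \<rightarrow>\<^sub>E carrier R" using a(1) by auto
    have cl: "a v \<odot>\<^bsub>func_space A\<^esub> v \<in> carrier (func_space A)" if "v \<in> unit_vec R A ` A" for v
      using that a(1) E by (intro F.smult_closed) auto
    have "F.lincomb a (unit_vec R A ` A) =
        (\<Oplus>\<^bsub>func_space A\<^esub>i\<in>A. a (unit_vec R A i) \<odot>\<^bsub>func_space A\<^esub> unit_vec R A i)"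
      unfolding F.lincomb_def using cl
      by (intro F.M.finsum_reindex unit_vec_inj[OF assms(2)] Pi_I)
    also have "\<dots> = family_comb (func_space A) A (unit_vec R A) ?c"
      unfolding family_comb_def using cl
      by (intro F.M.finsum_cong' refl Pi_I) (auto simp del: func_space_sel)
    also have "\<dots> = ?c" by (rule family_comb_unit_vec[OF A c])
    finally have "?c = (\<lambda>i\<in>A. \<zero>)" using a(2) by simp
    then show "\<forall>v \<in> unit_vec R A ` A. a v = \<zero>"
      by (metis (no_types, lifting) imageE restrict_apply')
  qed (use A E in auto)
  then show ?thesis
    unfolding free_module_def using E span_unit_vec[OF A] F.module_axioms by auto
qed

end

section \<open>Passing between presentations and generating families\<close>

text \<open>The basis supplied by \<open>free_module\<close> comes without a finiteness claim. Each
  of the finitely many generators involves only finitely many basis elements; the union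
  \<open>?D\<close> of these already spans \<open>F\<close>, and a further basis element would
  depend on it.\<close>

lemma finite_basis:
  assumes "fg_module R F" and "free_module R F" and nz: "\<one>\<^bsub>R\<^esub> \<noteq> \<zero>\<^bsub>R\<^esub>"
  obtains B where "finite B" and "B \<subseteq> carrier F" and "\<not> module.lin_dep R F B"
    and "module.span R F B = carrier F"
proof -
  interpret F: module R F using assms by (simp add: fg_module_def)
  from assms(1) obtain A where A: "finite A" "A \<subseteq> carrier F" "F.span A = carrier F"
    by (auto simp: fg_module_def)
  from assms(2) obtain B where B: "B \<subseteq> carrier F" "F.lin_indpt B" "F.span B = carrier F"
    by (auto simp: free_module_def)
  have "\<exists>C. finite C \<and> C \<subseteq> B \<and> a \<in> F.span C" if "a \<in> A" for a
  proof -
    have "a \<in> F.span B" using that A B by auto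
    then obtain c C where "finite C" "C \<subseteq> B" "c \<in> C \<rightarrow> carrier R" "a = F.lincomb c C"
      unfolding F.span_def by auto
    then show ?thesis unfolding F.span_def by blast
  qed
  then obtain C where C: "\<And>a. a \<in> A \<Longrightarrow> finite (C a) \<and> C a \<subseteq> B \<and> a \<in> F.span (C a)"
    by metis
  let ?D = "\<Union>a\<in>A. C a"
  have D: "finite ?D" "?D \<subseteq> B" using A C by auto
  with B(1) have DF: "?D \<subseteq> carrier F" by blast
  have "A \<subseteq> F.span ?D"
    using C F.span_is_monotone[of "C _" ?D] by blast
  then have span: "F.span ?D = carrier F"
    using F.span_is_subset[OF _ F.span_is_submodule[OF DF], of A] A(3)
      F.span_is_subset2[OF DF] by auto
  have "B \<subseteq> ?D"
  proof (rule ccontr)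
    assume "\<not> B \<subseteq> ?D"
    then obtain b where b: "b \<in> B" "b \<notin> ?D" by blast
    then have "b \<in> F.span ?D" using span B by auto
    then obtain c where c: "c \<in> ?D \<rightarrow> carrier R" "F.lincomb c ?D = b"
      using F.finite_in_span[OF D(1) DF] by blast
    \<comment> \<open>Moving \<open>b\<close> to the other side of its expansion over
      \<open>?D\<close> gives a dependency in \<open>B\<close>; the coefficient -1 at
      \<open>b\<close> is nonzero because \<open>R\<close> is nontrivial.\<close>
    let ?c = "c(b := \<ominus>\<^bsub>R\<^esub> \<one>\<^bsub>R\<^esub>)"
    have c': "?c \<in> ?D \<union> {b} \<rightarrow> carrier R" using c by auto
    have bF: "b \<in> carrier F" using b B by auto
    have "F.lincomb ?c (?D \<union> {b}) = ?c b \<odot>\<^bsub>F\<^esub> b \<oplus>\<^bsub>F\<^esub> F.lincomb ?c ?D"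
      using D DF c' b bF by (intro F.lincomb_insert)
    also have "F.lincomb ?c ?D = F.lincomb c ?D"
      using DF c b by (intro F.lincomb_cong) auto
    also have "?c b \<odot>\<^bsub>F\<^esub> b \<oplus>\<^bsub>F\<^esub> F.lincomb c ?D = \<zero>\<^bsub>F\<^esub>"
      using c(2) bF by (simp add: F.smult_minus_1 F.M.l_neg)
    finally have "F.lincomb ?c (?D \<union> {b}) = \<zero>\<^bsub>F\<^esub>" .
    moreover have "?c b \<noteq> \<zero>\<^bsub>R\<^esub>"
      using nz by (metis F.R.minus_minus F.R.minus_zero F.R.one_closed fun_upd_same)
    ultimately have "F.lin_dep B"
      using D b c' by (intro F.lin_dep_crit[of "?D \<union> {b}" B ?c b]) auto
    with B show False by simp
  qed
  then have "finite B" using D(1) by (rule finite_subset)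
  with B show thesis by (intro that)
qed

text \<open>The index type is left free because a family obtained over one ring is reused over the
  other, for which the definition prescribes a different element type;
  \<open>S_finitely_presentedI\<close> bridges the gap.\<close>

lemma S_finitely_presented_familyI:
  assumes "module R M" and nz: "\<one>\<^bsub>R\<^esub> \<noteq> \<zero>\<^bsub>R\<^esub>" and S: "S \<subseteq> carrier R"
    and A: "finite A" and x: "x \<in> A \<rightarrow> carrier M"
    and gen: "family_comb M A x ` (A \<rightarrow>\<^sub>E carrier R) = carrier M"
    and rel: "S_finite R S ((ring.func_space R A)\<lparr>carrier := relations R M A x\<rparr>)"
  shows "S_finitely_presented R S M"
proof -
  interpret M: module R M by fact
  let ?F = "M.func_space A" and ?K = "(M.func_space A)\<lparr>carrier := relations R M A x\<rparr>"
  interpret p: mod_hom R ?F M "family_comb M A x"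
    by (rule M.family_comb_hom[OF x A])
  have K: "submodule R (relations R M A x) ?F"
    by (rule M.relations_submodule[OF x A])
  have "mod_hom R ?K ?F (\<lambda>c. c)"
  proof (rule mod_homI)
    show "module R ?K" by (rule p.M.submodule_is_module[OF K])
  qed (use submodule.subset[OF K] p.M.module_axioms in auto)
  then have "short_exact R ?K ?F M (\<lambda>c. c) (family_comb M A x)"
    using p.mod_hom_axioms gen by (simp add: short_exact_def relations_def)
  then show ?thesis
    using rel M.fg_func_space[OF A] M.free_func_space[OF A nz]
    by (intro S_finitely_presentedI[OF S])
qed

text \<open>A finite basis \<open>B\<close> of \<open>F\<close> serves as index set and
  \<open>p\<close> as the family. The coordinate isomorphism turns \<open>F\<close> into the
  function space on \<open>B\<close>, and the kernel of \<open>p\<close>, which is the image of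
  \<open>K\<close>, into the relations.\<close>

lemma S_finitely_presented_familyE:
  fixes R :: "('a, 'r) ring_scheme"
  assumes fp: "S_finitely_presented R S M" and nz: "\<one>\<^bsub>R\<^esub> \<noteq> \<zero>\<^bsub>R\<^esub>" and S: "S \<subseteq> carrier R"
  obtains A :: "(nat \<Rightarrow> 'a) set" and x where "finite A" and "x \<in> A \<rightarrow> carrier M"
    and "family_comb M A x ` (A \<rightarrow>\<^sub>E carrier R) = carrier M"
    and "S_finite R S ((ring.func_space R A)\<lparr>carrier := relations R M A x\<rparr>)"
proof -
  from fp obtain K F :: "('a, nat \<Rightarrow> 'a) module" and i p where
    ex: "short_exact R K F M i p" and fin: "S_finite R S K"
    and F: "fg_module R F" "free_module R F"
    unfolding S_finitely_presented_def by blast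
  interpret R: cring R using ex by (simp add: short_exact_def mod_hom_def module_def)
  interpret i: mod_hom R K F i using ex by (simp add: short_exact_def)
  interpret p: mod_hom R F M p using ex by (simp add: short_exact_def)
  have i: "i ` carrier K = {y \<in> carrier F. p y = \<zero>\<^bsub>M\<^esub>}" and p: "p ` carrier F = carrier M"
    using ex by (auto simp: short_exact_def)
  obtain B where B: "finite B" "B \<subseteq> carrier F" "\<not> i.N.lin_dep B" "i.N.span B = carrier F"
    using finite_basis[OF F nz] .
  let ?E = "R.func_space B" and ?c = "family_comb F B (\<lambda>b. b)"
  have idB: "(\<lambda>b. b) \<in> B \<rightarrow> carrier F" using B by auto
  have pB: "p \<in> B \<rightarrow> carrier M" using B by auto
  interpret c: mod_hom R ?E F ?c by (rule i.N.family_comb_hom[OF idB B(1)])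
  have comb: "?c a = i.N.lincomb a B" for a
    by (simp add: family_comb_def i.N.lincomb_def)
  have "?c ` carrier ?E = carrier F"
  proof (intro equalityI subsetI)
    fix y assume "y \<in> carrier F"
    then obtain a where a: "a \<in> B \<rightarrow> carrier R" "i.N.lincomb a B = y"
      using i.N.finite_in_span[OF B(1,2)] B(4) by blast
    have "i.N.lincomb (restrict a B) B = y"
      using a B(2) by (subst a(2)[symmetric], intro i.N.lincomb_cong) auto
    then show "y \<in> ?c ` carrier ?E"
      using a by (intro image_eqI[of _ _ "restrict a B"]) (auto simp: comb)
  qed auto
  moreover have "inj_on ?c (carrier ?E)"
  proof (rule inj_onI)
    fix a b assume ab: "a \<in> carrier ?E" "b \<in> carrier ?E" "?c a = ?c b"
    have d: "a \<ominus>\<^bsub>?E\<^esub> b \<in> carrier ?E" using ab by (intro c.M.M.minus_closed)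
    have "?c (a \<ominus>\<^bsub>?E\<^esub> b) = \<zero>\<^bsub>F\<^esub>"
      using ab c.f_im[of b] by (simp add: c.f_minus i.N.M.minus_eq i.N.M.r_neg del: R.func_space_sel)
    \<comment> \<open>The differences of coordinates form a vanishing combination of the independent
      set \<open>B\<close>.\<close>
    then have "(a \<ominus>\<^bsub>?E\<^esub> b) v = \<zero>\<^bsub>R\<^esub>" if "v \<in> B" for v
      using i.N.lin_dep_crit[of B B "a \<ominus>\<^bsub>?E\<^esub> b" v] B d that by (auto simp: comb)
    then have "a \<ominus>\<^bsub>?E\<^esub> b = \<zero>\<^bsub>?E\<^esub>"
      using d by (intro extensionalityI[of _ B]) (auto simp: PiE_iff)
    then show "a = b" using ab by (metis c.M.M.minus_other_side c.M.M.r_zero c.M.M.zero_closed)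
  qed
  ultimately have bij: "bij_betw ?c (carrier ?E) (carrier F)"
    by (simp add: bij_betw_def)
  let ?g = "inv_into (carrier ?E) ?c"
  have pc: "p (?c a) = family_comb M B p a" if "a \<in> carrier ?E" for a
  proof -
    have "p (?c a) = (\<Oplus>\<^bsub>M\<^esub>b\<in>B. p (a b \<odot>\<^bsub>F\<^esub> b))"
      unfolding family_comb_def using that B by (intro p.hom_sum) (auto intro!: i.N.smult_closed)
    also have "\<dots> = family_comb M B p a"
      unfolding family_comb_def using that B
      by (intro p.N.M.finsum_cong' refl) (auto intro!: p.N.smult_closed p.f_smult)
    finally show ?thesis .
  qed
  have gen: "family_comb M B p ` (B \<rightarrow>\<^sub>E carrier R) = carrier M"
  proof -
    have "family_comb M B p ` carrier ?E = p ` ?c ` carrier ?E"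
      unfolding image_image using pc by (intro image_cong refl) simp
    then show ?thesis using bij p by (simp add: bij_betw_def)
  qed
  have rel: "relations R M B p = {a \<in> carrier ?E. p (?c a) = \<zero>\<^bsub>M\<^esub>}"
    using pc by (auto simp: relations_def)
  have "?g ` {y \<in> carrier F. p y = \<zero>\<^bsub>M\<^esub>} = relations R M B p"
  proof -
    have F_eq: "carrier F = ?c ` carrier ?E" using bij by (simp add: bij_betw_def)
    have "{y \<in> carrier F. p y = \<zero>\<^bsub>M\<^esub>} = ?c ` relations R M B p"
      unfolding rel F_eq by auto
    also have "?g ` \<dots> = relations R M B p"
      using bij by (intro inv_into_image_cancel) (auto simp: bij_betw_def rel)
    finally show ?thesis .
  qed
  then have im: "(?g \<circ> i) ` carrier K = relations R M B p"
    by (simp only: image_comp[symmetric] i)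
  interpret h: mod_hom R K ?E "?g \<circ> i"
    using i.mod_hom_axioms mod_hom_inv_into[OF c.mod_hom_axioms bij] by (rule mod_hom_comp)
  have "submodule R (carrier K) K"
    by (simp add: submodule_def i.M.module_axioms)
  \<comment> \<open>Updating \<open>K\<close> by its own carrier changes nothing; it gives
    \<open>K\<close> the shape that \<open>restrict_hom\<close> expects, which here cuts the target
    down to the relations.\<close>
  then have "mod_hom R (K\<lparr>carrier := carrier K\<rparr>) (?E\<lparr>carrier := relations R M B p\<rparr>) (?g \<circ> i)"
    using im p.N.relations_submodule[OF pB B(1)] by (intro h.restrict_hom) auto
  then have "S_finite R S (?E\<lparr>carrier := relations R M B p\<rparr>)"
    using im fin S by (intro S_finite_image[of R K _ "?g \<circ> i"]) simp_all
  with B(1) pB gen show thesis by (rule that)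
qed

text \<open>If \<open>t\<close> moves \<open>I\<close> into the span of \<open>G\<close>, the copies
  of \<open>G\<close> in each of the finitely many coordinates have a span containing every multiple
  \<open>t c\<close>: the one \<open>t\<close> handles all coordinates at once.\<close>

lemma (in cring) S_finite_func_space_ideal:
  assumes "ideal I R" and A: "finite A" and S: "S \<subseteq> carrier R"
    and fin: "S_finite R S (ideal_module R I)"
  shows "S_finite R S ((func_space A)\<lparr>carrier := A \<rightarrow>\<^sub>E I\<rparr>)"
proof -
  interpret I: ideal I R by fact
  interpret J: module R "ideal_module R I"
    by (rule ideal_module_module) (fact is_cring, fact)
  interpret F: module R "func_space A" by (rule func_space_is_module)
  have sub: "submodule R (A \<rightarrow>\<^sub>E I) (func_space A)"
    by (rule submodule.intro) (auto simp: F.module_axioms I.Icarr I.I_l_closed PiE_iff)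
  interpret P: module R "(func_space A)\<lparr>carrier := A \<rightarrow>\<^sub>E I\<rparr>"
    by (rule F.submodule_is_module[OF sub])
  have J_sel: "carrier (ideal_module R I) = I" "add (ideal_module R I) = add R"
    "smult (ideal_module R I) = mult R"
    by (simp_all add: ideal_module_def)
  \<comment> \<open>The embedding of \<open>I\<close> as coordinate \<open>a\<close>; its linearity
    carries the span of \<open>G\<close> into the function space.\<close>
  let ?e = "\<lambda>a r. \<lambda>b\<in>A. if b = a then r else \<zero>"
  have e: "mod_hom R (ideal_module R I) (func_space A) (?e a)" for a
    by (rule mod_homI)
      (auto simp: J.module_axioms F.module_axioms J_sel I.Icarr fun_eq_iff)
  from fin obtain G t where G: "finite G" "G \<subseteq> I" "t \<in> S"
    "\<And>r. r \<in> I \<Longrightarrow> t \<otimes> r \<in> J.span G"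
    unfolding S_finite_iff[OF J.module_axioms] J_sel by auto
  let ?H = "\<Union>a\<in>A. ?e a ` G"
  have H: "?H \<subseteq> A \<rightarrow>\<^sub>E I" using G by auto
  also have "\<dots> \<subseteq> carrier (func_space A)"
    unfolding func_space_sel by (rule PiE_mono) (rule I.a_subset)
  finally have HF: "?H \<subseteq> carrier (func_space A)" .
  have t: "t \<in> carrier R" using G(3) S by blast
  have "t \<odot>\<^bsub>func_space A\<^esub> c \<in> F.span ?H" if c: "c \<in> A \<rightarrow>\<^sub>E I" for c
  proof -
    have cI: "c a \<in> I" if "a \<in> A" for a using c that by (rule PiE_mem)
    have "?e a (t \<otimes> c a) \<in> F.span ?H" if a: "a \<in> A" for a
    proof -
      interpret e: mod_hom R "ideal_module R I" "func_space A" "?e a" by (rule e)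
      have "?e a (t \<otimes> c a) \<in> ?e a ` J.span G" using G(4)[OF cI[OF a]] by (rule imageI)
      also have "\<dots> = F.span (?e a ` G)"
        using G by (intro e.span_image[symmetric]) (simp add: J_sel)
      also have "\<dots> \<subseteq> F.span ?H" using a by (intro F.span_is_monotone) auto
      finally show ?thesis .
    qed
    then have "(\<Oplus>\<^bsub>func_space A\<^esub>a\<in>A. ?e a (t \<otimes> c a)) \<in> F.span ?H"
      by (intro F.submodule_finsum_closed F.span_is_submodule HF Pi_I)
    \<comment> \<open>Placing an entry of \<open>t c\<close> in slot \<open>a\<close> amounts to
      scaling the unit vector of \<open>a\<close> by it, so the sum is the expansion of
      \<open>t c\<close> in unit vectors.\<close>
    also have "(\<Oplus>\<^bsub>func_space A\<^esub>a\<in>A. ?e a (t \<otimes> c a)) =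
        family_comb (func_space A) A (unit_vec R A) (t \<odot>\<^bsub>func_space A\<^esub> c)"
      unfolding family_comb_def
      by (intro F.M.finsum_cong' refl)
        (auto simp: unit_vec_def t I.Icarr[OF cI] intro!: restrict_ext)
    also have "\<dots> = t \<odot>\<^bsub>func_space A\<^esub> c"
      by (rule family_comb_unit_vec[OF A]) (use t I.Icarr[OF cI] in auto)
    finally show ?thesis .
  qed
  moreover have "P.span ?H = F.span ?H"
    by (rule F.span_li_not_depend(1)[OF H sub])
  moreover have "finite ?H" using A G(1) by simp
  ultimately show ?thesis
    unfolding S_finite_iff[OF P.module_axioms] using H G(3)
    by (intro exI[of _ ?H] exI[of _ t]) (simp del: func_space_sel)
qed

section \<open>Reduction of coefficients\<close>

context surj_scalar_hom
begin

text \<open>The prefix \<open>S.\<close> comes from \<^locale>\<open>ring_hom_cring\<close> and refers to the target ring \<open>R'\<close>, not to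
  the multiplicative subset.\<close>

abbreviation map_coeffs :: "'i set \<Rightarrow> ('i \<Rightarrow> 'a) \<Rightarrow> 'i \<Rightarrow> 'c"
  where "map_coeffs A c \<equiv> \<lambda>i\<in>A. \<phi> (c i)"

lemma map_coeffs_image: "map_coeffs A ` (A \<rightarrow>\<^sub>E carrier R) = A \<rightarrow>\<^sub>E carrier R'"
proof (intro equalityI subsetI)
  fix d assume d: "d \<in> A \<rightarrow>\<^sub>E carrier R'"
  let ?g = "inv_into (carrier R) \<phi>"
  have g: "?g (d i) \<in> carrier R" "\<phi> (?g (d i)) = d i" if "i \<in> A" for i
  proof -
    have "d i \<in> \<phi> ` carrier R" using d that surj by auto
    then show "?g (d i) \<in> carrier R" "\<phi> (?g (d i)) = d i"
      by (rule inv_into_into, rule f_inv_into_f)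
  qed
  have "map_coeffs A (\<lambda>i\<in>A. ?g (d i)) = d"
    using d g by (intro extensionalityI[of _ A]) (auto simp: PiE_iff)
  then show "d \<in> map_coeffs A ` (A \<rightarrow>\<^sub>E carrier R)"
    using g(1) by (intro image_eqI[of _ _ "\<lambda>i\<in>A. ?g (d i)"]) auto
qed (auto simp: PiE_iff)

lemma map_coeffs_hom:
  "mod_hom R (R.func_space A) (restrict_scalars \<phi> (S.func_space A)) (map_coeffs A)"
proof (rule mod_homI)
  show "module R (restrict_scalars \<phi> (S.func_space A))"
    by (rule restrict_scalars_module[OF _ S.func_space_is_module]) unfold_locales
qed (auto simp: R.func_space_is_module PiE_iff intro!: restrict_ext)

lemma family_comb_restrict_scalars:
  assumes x: "x \<in> A \<rightarrow> carrier M" and c: "c \<in> A \<rightarrow>\<^sub>E carrier R"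
  shows "family_comb (restrict_scalars \<phi> M) A x c = family_comb M A x (map_coeffs A c)"
proof -
  have "\<phi> (c i) \<odot>\<^bsub>M\<^esub> x i \<in> carrier M" if "i \<in> A" for i
    using that x c by (intro M.smult_closed hom_closed) auto
  then show ?thesis
    unfolding family_comb_def finsum_restrict_scalars
    by (intro M.M.finsum_cong' refl Pi_I) simp_all
qed

lemma family_comb_restrict_scalars_image:
  assumes x: "x \<in> A \<rightarrow> carrier M"
  shows "family_comb (restrict_scalars \<phi> M) A x ` (A \<rightarrow>\<^sub>E carrier R) =
    family_comb M A x ` (A \<rightarrow>\<^sub>E carrier R')"
  unfolding map_coeffs_image[symmetric] image_image
  by (intro image_cong refl family_comb_restrict_scalars x)

text \<open>A combination over \<open>R\<close> depends only on the reduced coefficients, so the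
  relations over \<open>R\<close> are the full preimage of those over \<open>R'\<close>; since
  reduction of tuples is onto, nothing is missed.\<close>

lemma relations_image:
  assumes x: "x \<in> A \<rightarrow> carrier M"
  shows "map_coeffs A ` relations R (restrict_scalars \<phi> M) A x = relations R' M A x"
  unfolding relations_def map_coeffs_image[symmetric]
  using family_comb_restrict_scalars[OF x] by auto

text \<open>The right-hand map of the exact sequence. Its target is written as a restriction of
  scalars of a single \<open>R'\<close>-module so that \<open>S_finite_restrict_scalars_iff\<close>
  applies to it.\<close>

lemma relations_hom:
  assumes x: "x \<in> A \<rightarrow> carrier M" and A: "finite A"
  shows "mod_hom R ((R.func_space A)\<lparr>carrier := relations R (restrict_scalars \<phi> M) A x\<rparr>)
    (restrict_scalars \<phi> ((S.func_space A)\<lparr>carrier := relations R' M A x\<rparr>)) (map_coeffs A)"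
proof -
  interpret h: mod_hom R "R.func_space A" "restrict_scalars \<phi> (S.func_space A)" "map_coeffs A"
    by (rule map_coeffs_hom)
  interpret F: surj_scalar_hom R R' \<phi> "S.func_space A"
    by (intro surj_scalar_hom.intro surj_scalar_hom_axioms.intro S.func_space_is_module surj)
      unfold_locales
  show ?thesis
    unfolding restrict_scalars_carrier_update[symmetric]
    using x A relations_image[OF x]
    by (intro h.restrict_hom)
      (auto simp: F.submodule_restrict_scalars_iff intro!: M.relations_submodule
        rM.relations_submodule)
qed

text \<open>The family taken from a presentation over \<open>R\<close> also generates
  \<open>M\<close> over \<open>R'\<close>. Its relations over \<open>R'\<close> are a homomorphic
  image of those over \<open>R\<close>, hence \<open>S\<close>-finite over \<open>R\<close>, and
  this property passes to \<open>R'\<close> and the image of \<open>S\<close>.\<close>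

lemma S_finitely_presented_of_restrict_scalars:
  assumes "S_finitely_presented R S (restrict_scalars \<phi> M)"
    and S: "S \<subseteq> carrier R" and nz: "\<one>\<^bsub>R'\<^esub> \<noteq> \<zero>\<^bsub>R'\<^esub>"
  shows "S_finitely_presented R' (\<phi> ` S) M"
proof -
  have nz': "\<one>\<^bsub>R\<^esub> \<noteq> \<zero>\<^bsub>R\<^esub>" using nz hom_one hom_zero by metis
  obtain A :: "(nat \<Rightarrow> 'a) set" and x where A: "finite A"
    and "x \<in> A \<rightarrow> carrier (restrict_scalars \<phi> M)"
    and gen: "family_comb (restrict_scalars \<phi> M) A x ` (A \<rightarrow>\<^sub>E carrier R) =
      carrier (restrict_scalars \<phi> M)"
    and rel: "S_finite R S ((R.func_space A)\<lparr>carrier := relations R (restrict_scalars \<phi> M) A x\<rparr>)"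
    using S_finitely_presented_familyE[OF assms(1) nz' S] .
  then have x: "x \<in> A \<rightarrow> carrier M" by simp
  let ?K = "(S.func_space A)\<lparr>carrier := relations R' M A x\<rparr>"
  interpret K: surj_scalar_hom R R' \<phi> ?K
    by (intro surj_scalar_hom.intro surj_scalar_hom_axioms.intro surj
        module.submodule_is_module[OF S.func_space_is_module] M.relations_submodule x A)
      unfold_locales
  have "S_finite R S (restrict_scalars \<phi> ?K)"
    using relations_image[OF x]
    by (intro S_finite_image[OF relations_hom[OF x A] _ S rel]) simp
  then show ?thesis
    using S A x gen nz S.func_space_is_module
    by (intro S_finitely_presented_familyI[of R' M _ A x])
      (auto simp: K.S_finite_restrict_scalars_iff family_comb_restrict_scalars_image
        M.module_axioms)
qed

text \<open>The family taken from a presentation over \<open>R'\<close> is read over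
  \<open>R\<close>. Its relations are an extension of those over \<open>R'\<close> by a finite power
  of the kernel of \<open>\<phi>\<close>, so \<open>S_finite_extension\<close> applies.\<close>

lemma S_finitely_presented_restrict_scalars:
  assumes "S_finitely_presented R' (\<phi> ` S) M" and "submonoid S R" and nz: "\<one>\<^bsub>R'\<^esub> \<noteq> \<zero>\<^bsub>R'\<^esub>"
    and fin: "S_finite R S (ideal_module R (a_kernel R R' \<phi>))"
  shows "S_finitely_presented R S (restrict_scalars \<phi> M)"
proof -
  have S: "S \<subseteq> carrier R" using assms(2) by (rule submonoid.subset)
  have S': "\<phi> ` S \<subseteq> carrier R'" using S by auto
  have nz': "\<one>\<^bsub>R\<^esub> \<noteq> \<zero>\<^bsub>R\<^esub>" using nz hom_one hom_zero by metis
  obtain A :: "(nat \<Rightarrow> 'c) set" and x where A: "finite A" and x: "x \<in> A \<rightarrow> carrier M"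
    and gen: "family_comb M A x ` (A \<rightarrow>\<^sub>E carrier R') = carrier M"
    and rel: "S_finite R' (\<phi> ` S) ((S.func_space A)\<lparr>carrier := relations R' M A x\<rparr>)"
    using S_finitely_presented_familyE[OF assms(1) nz S'] .
  let ?K = "(S.func_space A)\<lparr>carrier := relations R' M A x\<rparr>"
  let ?L = "(R.func_space A)\<lparr>carrier := relations R (restrict_scalars \<phi> M) A x\<rparr>"
  interpret K: surj_scalar_hom R R' \<phi> ?K
    by (intro surj_scalar_hom.intro surj_scalar_hom_axioms.intro surj
        module.submodule_is_module[OF S.func_space_is_module] M.relations_submodule x A)
      unfold_locales
  \<comment> \<open>Coefficients in the kernel of \<open>\<phi>\<close> act as zero on
    \<open>M\<close>. Hence the kernel computed next consists of all tuples over that ideal, not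
    merely of some of them.\<close>
  have zero: "family_comb (restrict_scalars \<phi> M) A x c = \<zero>\<^bsub>M\<^esub>"
    if "c \<in> A \<rightarrow>\<^sub>E carrier R" "map_coeffs A c = (\<lambda>i\<in>A. \<zero>\<^bsub>R'\<^esub>)" for c
  proof -
    interpret p: mod_hom R' "S.func_space A" M "family_comb M A x"
      by (rule M.family_comb_hom[OF x A])
    show ?thesis
      using that p.f0_is_0 family_comb_restrict_scalars[OF x] by simp
  qed
  have "{c \<in> carrier ?L. map_coeffs A c = \<zero>\<^bsub>restrict_scalars \<phi> ?K\<^esub>} = A \<rightarrow>\<^sub>E a_kernel R R' \<phi>"
    (is "?Z = _")
  proof (intro equalityI subsetI)
    fix c assume c: "c \<in> ?Z"
    then have eq: "map_coeffs A c = (\<lambda>i\<in>A. \<zero>\<^bsub>R'\<^esub>)" by simp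
    have "\<phi> (c i) = \<zero>\<^bsub>R'\<^esub>" if "i \<in> A" for i
      using that fun_cong[OF eq, of i] by simp
    moreover have "c \<in> A \<rightarrow>\<^sub>E carrier R" using c by (simp add: relations_def)
    ultimately show "c \<in> A \<rightarrow>\<^sub>E a_kernel R R' \<phi>"
      unfolding a_kernel_def' by (simp add: PiE_iff)
  next
    fix c assume "c \<in> A \<rightarrow>\<^sub>E a_kernel R R' \<phi>"
    then have "c \<in> A \<rightarrow>\<^sub>E carrier R" "map_coeffs A c = (\<lambda>i\<in>A. \<zero>\<^bsub>R'\<^esub>)"
      unfolding a_kernel_def' by (simp_all add: PiE_iff cong: restrict_cong)
    then show "c \<in> ?Z" using zero by (simp add: relations_def)
  qed
  moreover have "ideal (a_kernel R R' \<phi>) R"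
    by (intro ring_hom_ring.kernel_is_ideal ring_hom_ringI2 R.ring_axioms S.ring_axioms homh)
  then have "S_finite R S ((R.func_space A)\<lparr>carrier := A \<rightarrow>\<^sub>E a_kernel R R' \<phi>\<rparr>)"
    by (rule R.S_finite_func_space_ideal[OF _ A S fin])
  ultimately have "S_finite R S (?L\<lparr>carrier := {c \<in> carrier ?L.
      map_coeffs A c = \<zero>\<^bsub>restrict_scalars \<phi> ?K\<^esub>}\<rparr>)"
    by simp
  moreover have "S_finite R S (restrict_scalars \<phi> ?K)"
    using rel by (simp add: K.S_finite_restrict_scalars_iff)
  moreover have "map_coeffs A ` carrier ?L = carrier (restrict_scalars \<phi> ?K)"
    using relations_image[OF x] by simp
  ultimately have "S_finite R S ?L"
    using S_finite_extension[OF relations_hom[OF x A] _ assms(2)] by blast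
  then show ?thesis
    using A x gen nz' S rM.module_axioms
    by (intro S_finitely_presented_familyI[of R _ S A x])
      (simp_all add: family_comb_restrict_scalars_image)
qed

end

section \<open>Specialization to the quotient map\<close>

theorem proposition2p8:
  fixes R :: "('a, 'r) ring_scheme" and S I :: "'a set"
    and M :: "('a set, 'm, 'e) module_scheme" and T :: "'a set set"
  assumes "cring R"
    and "submonoid S R"
    and "ideal I R"
    and "module (R Quot I) M"
    and "I \<inter> S = {}"
    and "T = {I +>\<^bsub>R\<^esub> s | s. s \<in> S}"
  shows "(S_finite R S (restrict_scalars (\<lambda>r. I +>\<^bsub>R\<^esub> r) M) \<longleftrightarrow> S_finite (R Quot I) T M) \<and>
         (S_finitely_presented R S (restrict_scalars (\<lambda>r. I +>\<^bsub>R\<^esub> r) M) \<longrightarrow>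
            S_finitely_presented (R Quot I) T M) \<and>
         (S_finite R S (ideal_module R I) \<longrightarrow>
            S_finitely_presented (R Quot I) T M \<longrightarrow>
            S_finitely_presented R S (restrict_scalars (\<lambda>r. I +>\<^bsub>R\<^esub> r) M))"
proof -
  interpret R: cring R by fact
  interpret I: ideal I R by fact
  interpret S: submonoid S R by fact
  have surj: "(+>\<^bsub>R\<^esub>) I ` carrier R = carrier (R Quot I)"
    by (auto simp: FactRing_def A_RCOSETS_def')
  have zero: "\<zero>\<^bsub>R Quot I\<^esub> = I" and one: "\<one>\<^bsub>R Quot I\<^esub> = I +>\<^bsub>R\<^esub> \<one>\<^bsub>R\<^esub>"
    by (simp_all add: FactRing_def)
  interpret h: surj_scalar_hom R "R Quot I" "(+>\<^bsub>R\<^esub>) I" M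
    by (intro surj_scalar_hom.intro surj_scalar_hom_axioms.intro surj assms(4)
        I.rcos_ring_hom_cring assms(1))
  have mem: "r \<in> I \<longleftrightarrow> I +>\<^bsub>R\<^esub> r = I" if "r \<in> carrier R" for r
    using that I.rcos_const_imp_mem I.a_rcos_const by blast
  \<comment> \<open>Identifies the ideal in the finiteness hypothesis with the kernel that the
    converse refers to.\<close>
  have ker: "a_kernel R (R Quot I) ((+>\<^bsub>R\<^esub>) I) = I"
    unfolding a_kernel_def' zero using mem I.Icarr by blast
  have "\<one>\<^bsub>R\<^esub> \<notin> I" using assms(5) S.one_closed by blast
  \<comment> \<open>Disjointness enters here: 1 lies in \<open>S\<close>, hence not in
    \<open>I\<close>, so its coset is not the zero coset.\<close>
  then have nz: "\<one>\<^bsub>R Quot I\<^esub> \<noteq> \<zero>\<^bsub>R Quot I\<^esub>"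
    unfolding zero one using mem[OF R.one_closed] by blast
  have T: "T = (+>\<^bsub>R\<^esub>) I ` S" using assms(6) by auto
  show ?thesis
    unfolding T
    using h.S_finite_restrict_scalars_iff[of S]
      h.S_finitely_presented_of_restrict_scalars[OF _ S.subset nz]
      h.S_finitely_presented_restrict_scalars[OF _ assms(2) nz, unfolded ker]
    by blast
qed

end
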